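(* Let $p>0$ and let $n\ge 1$ be an integer. Let $g_1,\ldots,g_n$ be i.i.d. real random variables with density $\frac{1}{2\Gamma(1+1/p)}e^{-|t|^p}$ ($t\in\mathbb{R}$), and let $Z$ be an exponential random variable independent of $g_1,\ldots,g_n$ (i.e., the density of $Z$ is $e^{-t}$, $t\ge 0$). Denote $G=(g_1,\ldots,g_n)\in\mathbb{R}^n$ and consider the random vector $$V=\frac{G}{\left(\sum_{i=1}^n|g_i|^p+Z\right)^{1/p}}.$$ Then $V$ generates the normalized volume measure on $B_p^n$, that is, for every measurable $A\subset\mathbb{R}^n$, $$P(V\in A)=\frac{\mathrm{vol}(A\cap B_p^n)}{\mathrm{vol}(B_p^n)}.$$
   Context: For $p>0$ and $x\in\mathbb{R}^n$, $\|x\|_p=(\sum_{i=1}^n|x_i|^p)^{1/p}$ and $B_p^n=\{x\in\mathbb{R}^n:\|x\|_p\le 1\}$. $\mathrm{vol}$ denotes Lebesgue measure on $\mathbb{R}^n$. *)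

theory Defs
  imports "HOL-Probability.Probability"
begin

(* A quasi-norm only, when 0 < p < 1. *)
definition lp_norm :: "real \<Rightarrow> real ^ 'n \<Rightarrow> real"
  where "lp_norm p x = (\<Sum>i\<in>UNIV. \<bar>x $ i\<bar> powr p) powr (1 / p)"

definition lp_ball :: "real \<Rightarrow> (real ^ 'n) set"
  where "lp_ball p = {x. lp_norm p x \<le> 1}"

definition gen_gauss_density :: "real \<Rightarrow> real \<Rightarrow> real"
  where "gen_gauss_density p t = exp (- (\<bar>t\<bar> powr p)) / (2 * Gamma (1 + 1 / p))"

end

theory Submission
  imports Defs
begin

text \<open>The expectation of \<open>F V\<close> is a constant times the integral of
  \<open>exp (- (\<Sum>|x\<^sub>i|\<^sup>p + t)) F(x / (\<Sum>|x\<^sub>i|\<^sup>p + t)\<^bsup>1/p\<^esup>)\<close>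
  over all \<open>x\<close> and all \<open>t \<ge> 0\<close>. Substituting \<open>s = \<Sum>|x\<^sub>i|\<^sup>p + t\<close> for \<open>t\<close>,
  exchanging the integrals and then substituting \<open>x = s\<^bsup>1/p\<^esup> y\<close> turns the constraint
  \<open>\<Sum>|x\<^sub>i|\<^sup>p \<le> s\<close> into \<open>y \<in> B\<^sub>p\<close>, so the integral factors into one over \<open>s\<close> and the integral
  of \<open>F\<close> over the ball. The constant in front does not depend on \<open>F\<close> and need not be
  evaluated, since \<open>F = 1\<close> normalizes it.\<close>

section \<open>Lebesgue measure and independent coordinates on \<open>real ^ 'n\<close>\<close>

lemma borel_measurable_vec_component [measurable]:
  "(\<lambda>x :: real ^ 'n. x $ i) \<in> borel_measurable borel"
  by (intro borel_measurable_continuous_onI continuous_intros)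

lemma borel_measurable_vec_lambda:
  fixes f :: "'n::finite \<Rightarrow> 'a \<Rightarrow> real"
  assumes "\<And>i. f i \<in> borel_measurable M"
  shows "(\<lambda>x. \<chi> i. f i x) \<in> borel_measurable M"
proof -
  have "(\<lambda>x. (\<chi> i. f i x) \<bullet> b) \<in> borel_measurable M" if "b \<in> Basis" for b :: "real ^ 'n"
  proof -
    obtain i where "b = axis i 1"
      using \<open>b \<in> Basis\<close> by (auto simp: Basis_vec_def)
    then show ?thesis
      using assms by (simp add: inner_axis)
  qed
  then show ?thesis
    by (subst borel_measurable_euclidean_space) auto
qed

lemma measurable_vec_lambda_PiM [measurable]:
  "(\<lambda>f. \<chi> i. f i) \<in> PiM (UNIV :: 'n::finite set) (\<lambda>_. borel :: real measure) \<rightarrow>\<^sub>M borel"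
  by (rule borel_measurable_vec_lambda) simp

text \<open>Lebesgue measure is determined by its values on open boxes, and a box pulls back under
  \<open>vec_lambda\<close> to a product of open intervals. This bridge carries product densities
  from the function space, where \<open>PiM\<close> lives, over to vectors.\<close>

lemma lborel_vec_eq_distr_PiM:
  "(lborel :: (real ^ 'n) measure)
    = distr (PiM (UNIV :: 'n::finite set) (\<lambda>_. lborel)) borel (\<lambda>f. \<chi> i. f i)"
proof (rule lborel_eqI)
  interpret product_sigma_finite "\<lambda>_ :: 'n. lborel :: real measure" ..
  fix l u :: "real ^ 'n"
  assume le: "\<And>b. b \<in> Basis \<Longrightarrow> l \<bullet> b \<le> u \<bullet> b"
  have le': "l $ i \<le> u $ i" for i
    using le[of "axis i 1"] by (simp add: inner_axis axis_in_Basis_iff)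
  have meas: "(\<lambda>f. \<chi> i. f i) \<in> PiM (UNIV :: 'n set) (\<lambda>_. lborel :: real measure) \<rightarrow>\<^sub>M borel"
    by (rule borel_measurable_vec_lambda) simp
  have "(\<lambda>f. \<chi> i. f i) -` box l u \<inter> space (PiM (UNIV :: 'n set) (\<lambda>_. lborel :: real measure))
      = PiE UNIV (\<lambda>i. {l $ i<..<u $ i})"
    by (auto simp: mem_box_cart space_PiM PiE_def Pi_def extensional_def)
  then have "emeasure (distr (PiM (UNIV :: 'n set) (\<lambda>_. lborel)) borel (\<lambda>f. \<chi> i. f i)) (box l u)
      = (\<Prod>i\<in>UNIV. emeasure lborel {l $ i<..<u $ i})"
    by (simp add: emeasure_distr[OF meas] emeasure_PiM)
  also have "\<dots> = ennreal (\<Prod>i\<in>UNIV. u $ i - l $ i)"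
    using le' by (simp add: prod_ennreal)
  also have "(\<Prod>i\<in>UNIV. u $ i - l $ i) = (\<Prod>b\<in>Basis. (u - l) \<bullet> b)"
  proof -
    have "(Basis :: (real ^ 'n) set) = (\<lambda>i. axis i 1) ` UNIV"
      by (auto simp: Basis_vec_def)
    moreover have "inj (\<lambda>i :: 'n. axis i (1 :: real))"
      by (auto simp: inj_on_def axis_eq_axis)
    ultimately have "(\<Prod>b\<in>Basis. (u - l) \<bullet> b) = (\<Prod>i\<in>UNIV. (u - l) \<bullet> axis i 1)"
      by (metis (no_types, lifting) comp_apply prod.cong prod.reindex)
    then show ?thesis
      by (simp add: inner_axis)
  qed
  finally show "emeasure (distr (PiM (UNIV :: 'n set) (\<lambda>_. lborel)) borel (\<lambda>f. \<chi> i. f i)) (box l u)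
      = ennreal (\<Prod>b\<in>Basis. (u - l) \<bullet> b)" .
qed simp

text \<open>It suffices to compare the two measures on rectangles \<open>PiE I A\<close>, where the
  indicator is itself a product and the integral therefore splits into one-dimensional ones.
  Sigma-finiteness of the factors is what makes the product measure unique.\<close>

lemma PiM_density_lborel:
  fixes f :: "'i \<Rightarrow> real \<Rightarrow> ennreal"
  assumes I: "finite I" and f [measurable]: "\<And>i. f i \<in> borel_measurable borel"
    and sf: "\<And>i. sigma_finite_measure (density lborel (f i))"
  shows "PiM I (\<lambda>i. density lborel (f i))
    = density (PiM I (\<lambda>_. lborel)) (\<lambda>x. \<Prod>i\<in>I. f i (x i))"
proof -
  interpret L: product_sigma_finite "\<lambda>_ :: 'i. lborel :: real measure" ..
  interpret product_sigma_finite "\<lambda>i. density lborel (f i)"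
    by (rule product_sigma_finite.intro) (rule sf)
  show ?thesis
  proof (rule PiM_eqI[symmetric])
    fix A :: "'i \<Rightarrow> real set"
    assume "\<And>i. i \<in> I \<Longrightarrow> A i \<in> sets (density lborel (f i))"
    then have A: "i \<in> I \<Longrightarrow> A i \<in> sets borel" for i
      by simp
    have meas: "PiE I A \<in> sets (PiM I (\<lambda>_. lborel))"
      using A I by (intro sets_PiM_I_finite) auto
    have "(\<lambda>x. \<Prod>i\<in>I. f i (x i)) \<in> borel_measurable (PiM I (\<lambda>_. lborel))"
      by measurable
    then have "emeasure (density (PiM I (\<lambda>_. lborel)) (\<lambda>x. \<Prod>i\<in>I. f i (x i))) (PiE I A)
        = (\<integral>\<^sup>+x. (\<Prod>i\<in>I. f i (x i)) * indicator (PiE I A) x \<partial>PiM I (\<lambda>_. lborel))"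
      by (intro emeasure_density meas)
    also have "\<dots> = (\<integral>\<^sup>+x. (\<Prod>i\<in>I. f i (x i) * indicator (A i) (x i)) \<partial>PiM I (\<lambda>_. lborel))"
    proof (rule nn_integral_cong)
      fix x :: "'i \<Rightarrow> real" assume "x \<in> space (PiM I (\<lambda>_. lborel))"
      then have "(indicator (PiE I A) x :: ennreal) = (\<Prod>i\<in>I. indicator (A i) (x i))"
        using I by (auto simp: indicator_def PiE_iff space_PiM prod_eq_1_iff prod_zero_iff split: if_splits)
      then show "(\<Prod>i\<in>I. f i (x i)) * indicator (PiE I A) x
          = (\<Prod>i\<in>I. f i (x i) * indicator (A i) (x i))"
        by (simp add: prod.distrib)
    qed
    also have "\<dots> = (\<Prod>i\<in>I. \<integral>\<^sup>+t. f i t * indicator (A i) t \<partial>lborel)"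
      using A by (intro L.product_nn_integral_prod I) simp
    also have "\<dots> = (\<Prod>i\<in>I. emeasure (density lborel (f i)) (A i))"
      using A by (intro prod.cong refl) (simp add: emeasure_density)
    finally show "emeasure (density (PiM I (\<lambda>_. lborel)) (\<lambda>x. \<Prod>i\<in>I. f i (x i))) (PiE I A)
        = (\<Prod>i\<in>I. emeasure (density lborel (f i)) (A i))" .
  next
    show "sets (density (PiM I (\<lambda>_. lborel)) (\<lambda>x. \<Prod>i\<in>I. f i (x i)))
        = sets (PiM I (\<lambda>i. density lborel (f i)))"
      unfolding sets_density by (intro sets_PiM_cong) simp_all
  qed (rule I)
qed

text \<open>Independence makes the joint law on the function space the product of the marginal laws.
  That product has a product density, which is then pushed forward along
  \<open>vec_lambda\<close>.\<close>

lemma (in prob_space) distr_vec_indep: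
  fixes g :: "'n::finite \<Rightarrow> 'a \<Rightarrow> real"
  assumes indep: "indep_vars (\<lambda>_. borel) g UNIV"
    and dens: "\<And>i. distributed M lborel (g i) (f i)"
  shows "distr M borel (\<lambda>\<omega>. \<chi> i. g i \<omega>) = density lborel (\<lambda>x. \<Prod>i\<in>UNIV. f i (x $ i))"
proof -
  have f [measurable]: "f i \<in> borel_measurable borel" for i
    using distributed_borel_measurable[OF dens[of i]] by simp
  have g [measurable]: "g i \<in> borel_measurable M" for i
    using distributed_measurable[OF dens[of i]] by simp
  have dg: "distr M borel (g i) = density lborel (f i)" for i
    using distributed_distr_eq_density[OF dens[of i]] by (simp cong: distr_cong)
  \<comment> \<open>This density is the law of \<open>g i\<close>, hence a probability
    measure.\<close>
  have sf: "sigma_finite_measure (density lborel (f i))" for i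
    unfolding dg[symmetric] by (intro prob_space_imp_sigma_finite prob_space_distr g)
  have "distr M borel (\<lambda>\<omega>. \<chi> i. g i \<omega>)
      = distr (distr M (PiM UNIV (\<lambda>_. borel)) (\<lambda>\<omega> i. g i \<omega>)) borel (\<lambda>h. \<chi> i. h i)"
    by (subst distr_distr) (auto simp: comp_def intro!: measurable_vec_lambda_PiM measurable_PiM_single')
  also have "distr M (PiM UNIV (\<lambda>_. borel)) (\<lambda>\<omega> i. g i \<omega>) = PiM UNIV (\<lambda>i. density lborel (f i))"
    using indep_vars_iff_distr_eq_PiM[of UNIV g "\<lambda>_. borel"] indep g by (simp add: dg restrict_def)
  also have "\<dots> = density (PiM UNIV (\<lambda>_. lborel)) (\<lambda>x. \<Prod>i\<in>UNIV. f i (x i))"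
    by (intro PiM_density_lborel sf) auto
  also have "distr \<dots> borel (\<lambda>h. \<chi> i. h i)
      = density (distr (PiM UNIV (\<lambda>_. lborel)) borel (\<lambda>h. \<chi> i. h i)) (\<lambda>x. \<Prod>i\<in>UNIV. f i (x $ i))"
    by (subst density_distr) (auto intro!: borel_measurable_vec_lambda)
  also have "\<dots> = density lborel (\<lambda>x. \<Prod>i\<in>UNIV. f i (x $ i))"
    by (simp add: lborel_vec_eq_distr_PiM[symmetric])
  finally show ?thesis .
qed

section \<open>Scaling, the p-ball and the radial substitution\<close>

lemma nn_integral_lborel_scaleR:
  fixes f :: "'a::euclidean_space \<Rightarrow> ennreal"
  assumes [measurable]: "f \<in> borel_measurable borel" and c: "c \<noteq> 0"
  shows "(\<integral>\<^sup>+x. f x \<partial>lborel) = ennreal (\<bar>c\<bar> ^ DIM('a)) * (\<integral>\<^sup>+x. f (c *\<^sub>R x) \<partial>lborel)"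
  by (subst lborel_affine[OF c, of 0])
     (simp add: nn_integral_density nn_integral_distr nn_integral_cmult)

text \<open>For \<open>p > 0\<close> this is the p-th power of \<open>lp_norm p x\<close>. Without
  the outer root it is additive over the coordinates, so its exponential factorizes, and it is
  homogeneous of degree \<open>p\<close>.\<close>

abbreviation lp_sum :: "real \<Rightarrow> real ^ 'n \<Rightarrow> real"
  where "lp_sum p x \<equiv> \<Sum>i\<in>UNIV. \<bar>x $ i\<bar> powr p"

lemma mem_lp_ball_iff:
  assumes "p > 0"
  shows "x \<in> lp_ball p \<longleftrightarrow> lp_sum p x \<le> 1"
proof -
  have "0 \<le> lp_sum p x"
    by (intro sum_nonneg) auto
  then have "lp_sum p x powr (1 / p) \<le> 1 \<longleftrightarrow> lp_sum p x \<le> 1"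
    using assms powr_le1[of "1 / p" "lp_sum p x"] powr_less_mono2[of "1 / p" 1 "lp_sum p x"]
    by (auto simp: not_le[symmetric])
  then show ?thesis
    by (simp add: lp_ball_def lp_norm_def)
qed

lemma lp_sum_scaleR:
  assumes "p > 0" "s > 0"
  shows "lp_sum p ((s powr (1 / p)) *\<^sub>R x) = s * lp_sum p x"
  using assms by (simp add: abs_mult powr_mult powr_powr sum_distrib_left)

lemma sets_lp_ball [measurable]:
  assumes "p > 0"
  shows "(lp_ball p :: (real ^ 'n::finite) set) \<in> sets borel"
proof -
  have "(lp_ball p :: (real ^ 'n) set) = {x \<in> space borel. lp_sum p x \<le> 1}"
    using mem_lp_ball_iff[OF assms] by auto
  also have "\<dots> \<in> sets borel"
    by measurable
  finally show ?thesis .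
qed

text \<open>The first factor on the right is the value of the Gamma function at
  \<open>CARD('n) / p + 1\<close>, left as an integral; the power of \<open>s powr (1 / p)\<close>
  in it is the Jacobian of the scaling in \<open>x\<close>.\<close>

lemma nn_integral_radial_decoupling:
  fixes F :: "real ^ 'n::finite \<Rightarrow> ennreal"
  assumes p: "p > 0" and F [measurable]: "F \<in> borel_measurable borel"
  shows "(\<integral>\<^sup>+x. ennreal (exp (- lp_sum p x)) * (\<integral>\<^sup>+t. ennreal (exponential_density 1 t)
            * F ((1 / (lp_sum p x + t) powr (1 / p)) *\<^sub>R x) \<partial>lborel) \<partial>lborel)
      = (\<integral>\<^sup>+s. ennreal (exp (- s)) * ennreal (s powr (1 / p)) ^ CARD('n) * indicator {0<..} s \<partial>lborel)
        * (\<integral>\<^sup>+y. F y * indicator (lp_ball p) y \<partial>lborel)"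
proof -
  \<comment> \<open>The integrand in the variables \<open>x\<close> and
    \<open>s = lp_sum p x + t\<close>. The indicator records the condition \<open>t \<ge> 0\<close>
    from the support of the exponential density.\<close>
  define H :: "real ^ 'n \<Rightarrow> real \<Rightarrow> ennreal" where
    "H x s = ennreal (exp (- s)) * indicator {r. lp_sum p x \<le> r} s
       * F ((1 / s powr (1 / p)) *\<^sub>R x)" for x s
  have H_meas [measurable]: "case_prod H \<in> borel_measurable (borel \<Otimes>\<^sub>M borel)"
    unfolding H_def by measurable
  have inner: "ennreal (exp (- lp_sum p x)) * (\<integral>\<^sup>+t. ennreal (exponential_density 1 t)
        * F ((1 / (lp_sum p x + t) powr (1 / p)) *\<^sub>R x) \<partial>lborel) = (\<integral>\<^sup>+s. H x s \<partial>lborel)" for x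
  proof -
    have "ennreal (exp (- lp_sum p x)) * (\<integral>\<^sup>+t. ennreal (exponential_density 1 t)
        * F ((1 / (lp_sum p x + t) powr (1 / p)) *\<^sub>R x) \<partial>lborel)
      = (\<integral>\<^sup>+t. ennreal (exp (- lp_sum p x)) * (ennreal (exponential_density 1 t)
        * F ((1 / (lp_sum p x + t) powr (1 / p)) *\<^sub>R x)) \<partial>lborel)"
      by (rule nn_integral_cmult[symmetric]) measurable
    \<comment> \<open>The factor 1 puts the translation into the affine form that
      \<open>nn_integral_real_affine\<close> expects.\<close>
    also have "\<dots> = (\<integral>\<^sup>+t. H x (lp_sum p x + 1 * t) \<partial>lborel)"
    proof (rule nn_integral_cong)
      fix t
      have "ennreal (exp (- lp_sum p x)) * ennreal (exp (- t)) = ennreal (exp (- (lp_sum p x + t)))"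
        by (simp flip: ennreal_mult' exp_add)
      then show "ennreal (exp (- lp_sum p x)) * (ennreal (exponential_density 1 t)
          * F ((1 / (lp_sum p x + t) powr (1 / p)) *\<^sub>R x)) = H x (lp_sum p x + 1 * t)"
        by (simp add: H_def exponential_density_def indicator_def flip: mult.assoc)
    qed
    also have "\<dots> = (\<integral>\<^sup>+s. H x s \<partial>lborel)"
      by (subst (2) nn_integral_real_affine[where c = 1 and t = "lp_sum p x"]) auto
    finally show ?thesis .
  qed
  \<comment> \<open>The value \<open>s = 0\<close> is left out: scaling by
    \<open>s powr (1 / p)\<close> degenerates there, while \<open>H x s\<close> may still be nonzero
    at \<open>x = 0\<close>. A single \<open>s\<close> is null, so the identity almost everywhere is
    enough below.\<close>
  have outer: "(\<integral>\<^sup>+x. H x s \<partial>lborel)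
      = ennreal (exp (- s)) * ennreal (s powr (1 / p)) ^ CARD('n) * indicator {0<..} s
        * (\<integral>\<^sup>+y. F y * indicator (lp_ball p) y \<partial>lborel)" if "s \<noteq> 0" for s
  proof (cases "s > 0")
    case True
    have "(\<integral>\<^sup>+x. H x s \<partial>lborel)
        = ennreal (\<bar>s powr (1 / p)\<bar> ^ DIM(real ^ 'n)) * (\<integral>\<^sup>+y. H ((s powr (1 / p)) *\<^sub>R y) s \<partial>lborel)"
      using True by (intro nn_integral_lborel_scaleR) auto
    also have "(\<integral>\<^sup>+y. H ((s powr (1 / p)) *\<^sub>R y) s \<partial>lborel)
        = (\<integral>\<^sup>+y. ennreal (exp (- s)) * (F y * indicator (lp_ball p) y) \<partial>lborel)"
    proof (rule nn_integral_cong)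
      fix y :: "real ^ 'n"
      have "lp_sum p ((s powr (1 / p)) *\<^sub>R y) \<le> s \<longleftrightarrow> y \<in> lp_ball p"
        unfolding lp_sum_scaleR[OF p True] mem_lp_ball_iff[OF p]
        using True by (simp add: field_simps)
      then show "H ((s powr (1 / p)) *\<^sub>R y) s = ennreal (exp (- s)) * (F y * indicator (lp_ball p) y)"
        using True by (simp add: H_def indicator_def)
    qed
    also have "\<dots> = ennreal (exp (- s)) * (\<integral>\<^sup>+y. F y * indicator (lp_ball p) y \<partial>lborel)"
      using p by (intro nn_integral_cmult) auto
    finally show ?thesis
      using True by (simp add: ennreal_power mult_ac)
  next
    case False
    \<comment> \<open>Here \<open>s < 0\<close>, so no \<open>x\<close> satisfies the constraint and
      both sides vanish.\<close>
    have "0 \<le> lp_sum p x" for x :: "real ^ 'n"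
      by (intro sum_nonneg) auto
    then have "\<not> lp_sum p x \<le> s" for x :: "real ^ 'n"
      using False that by (meson leD le_less_trans linorder_neqE_linordered_idom not_le order_trans)
    then show ?thesis
      using False by (simp add: H_def)
  qed
  have "(\<integral>\<^sup>+x. \<integral>\<^sup>+s. H x s \<partial>lborel \<partial>lborel) = (\<integral>\<^sup>+s. \<integral>\<^sup>+x. H x s \<partial>lborel \<partial>lborel)"
    by (intro lborel_pair.Fubini'[symmetric]) simp
  also have "\<dots> = (\<integral>\<^sup>+s. ennreal (exp (- s)) * ennreal (s powr (1 / p)) ^ CARD('n) * indicator {0<..} s
        * (\<integral>\<^sup>+y. F y * indicator (lp_ball p) y \<partial>lborel) \<partial>lborel)"
    using AE_lborel_singleton[of 0] outer by (intro nn_integral_cong_AE) auto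
  also have "\<dots> = (\<integral>\<^sup>+s. ennreal (exp (- s)) * ennreal (s powr (1 / p)) ^ CARD('n) * indicator {0<..} s \<partial>lborel)
        * (\<integral>\<^sup>+y. F y * indicator (lp_ball p) y \<partial>lborel)"
    by (intro nn_integral_multc) measurable
  finally show ?thesis
    by (simp add: inner)
qed

section \<open>The joint law of the random vector and the exponential variable\<close>

text \<open>The index \<open>None\<close> stands for \<open>Z\<close> and \<open>Some i\<close> for
  \<open>g i\<close>. Functions of disjoint blocks of an independent family are independent: the
  singleton blocks \<open>{Some i}\<close> give the first claim, the blocks
  \<open>range Some\<close> and \<open>{None}\<close> the second.\<close>

lemma (in prob_space) indep_vars_case_optionD:
  fixes g :: "'i::finite \<Rightarrow> 'a \<Rightarrow> real"
  assumes indep: "indep_vars (\<lambda>_. borel) (case_option Z g) UNIV"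
  shows "indep_vars (\<lambda>_. borel) g UNIV"
    and "distr M (borel \<Otimes>\<^sub>M borel) (\<lambda>\<omega>. (\<chi> i. g i \<omega>, Z \<omega>))
      = distr M borel (\<lambda>\<omega>. \<chi> i. g i \<omega>) \<Otimes>\<^sub>M distr M borel Z"
proof -
  have "indep_vars (\<lambda>i. PiM {Some i} (\<lambda>_. borel))
      (\<lambda>i \<omega>. restrict (\<lambda>j. case_option Z g j \<omega>) {Some i}) UNIV"
    by (rule indep_vars_restrict[OF indep]) (auto simp: disjoint_family_on_def)
  then have "indep_vars (\<lambda>_. borel)
      (\<lambda>i \<omega>. (\<lambda>h. h (Some i)) (restrict (\<lambda>j. case_option Z g j \<omega>) {Some i})) UNIV"
    by (rule indep_vars_compose2) (auto intro!: measurable_component_singleton)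
  then show "indep_vars (\<lambda>_. borel) g UNIV"
    by simp
next
  let ?S = "PiM (range Some) (\<lambda>_. borel) :: ('i option \<Rightarrow> real) measure"
  let ?T = "PiM {None} (\<lambda>_. borel) :: ('i option \<Rightarrow> real) measure"
  define X where "X \<omega> = restrict (\<lambda>i. case_option Z g i \<omega>) (range Some)" for \<omega>
  define Y where "Y \<omega> = restrict (\<lambda>i. case_option Z g i \<omega>) {None}" for \<omega>
  have "indep_var ?S X ?T Y"
    unfolding X_def[abs_def] Y_def[abs_def] by (rule indep_var_restrict[OF indep]) auto
  then have X [measurable]: "X \<in> M \<rightarrow>\<^sub>M ?S" and Y [measurable]: "Y \<in> M \<rightarrow>\<^sub>M ?T"
    and joint: "distr M ?S X \<Otimes>\<^sub>M distr M ?T Y = distr M (?S \<Otimes>\<^sub>M ?T) (\<lambda>\<omega>. (X \<omega>, Y \<omega>))"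
    using indep_var_distribution_eq by blast+
  \<comment> \<open>Each of \<open>\<phi>\<close> and \<open>\<psi>\<close> reads a single block, so
    the product form of the joint law of \<open>X\<close> and \<open>Y\<close> survives the
    pushforward along the pair of maps.\<close>
  define \<phi> :: "('i option \<Rightarrow> real) \<Rightarrow> real ^ 'i" where "\<phi> h = (\<chi> i. h (Some i))" for h
  define \<psi> :: "('i option \<Rightarrow> real) \<Rightarrow> real" where "\<psi> h = h None" for h
  have \<phi> [measurable]: "\<phi> \<in> ?S \<rightarrow>\<^sub>M borel"
    unfolding \<phi>_def by (intro borel_measurable_vec_lambda measurable_component_singleton) auto
  have \<psi> [measurable]: "\<psi> \<in> ?T \<rightarrow>\<^sub>M borel"
    unfolding \<psi>_def by (intro measurable_component_singleton) auto
  have G: "(\<lambda>\<omega>. \<chi> i. g i \<omega>) = \<phi> \<circ> X" and Z: "Z = \<psi> \<circ> Y"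
    by (simp_all add: fun_eq_iff X_def Y_def \<phi>_def \<psi>_def vec_eq_iff)
  have "distr M borel (\<phi> \<circ> X) \<Otimes>\<^sub>M distr M borel (\<psi> \<circ> Y)
      = distr (distr M ?S X) borel \<phi> \<Otimes>\<^sub>M distr (distr M ?T Y) borel \<psi>"
    by (simp add: distr_distr)
  also have "\<dots> = distr (distr M ?S X \<Otimes>\<^sub>M distr M ?T Y) (borel \<Otimes>\<^sub>M borel) (\<lambda>(x, y). (\<phi> x, \<psi> y))"
    by (intro pair_measure_distr prob_space_imp_sigma_finite prob_space.prob_space_distr prob_space_distr)
       auto
  also have "\<dots> = distr M (borel \<Otimes>\<^sub>M borel) (\<lambda>\<omega>. ((\<phi> \<circ> X) \<omega>, (\<psi> \<circ> Y) \<omega>))"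
    unfolding joint by (subst distr_distr) (auto simp: comp_def)
  finally show "distr M (borel \<Otimes>\<^sub>M borel) (\<lambda>\<omega>. (\<chi> i. g i \<omega>, Z \<omega>))
      = distr M borel (\<lambda>\<omega>. \<chi> i. g i \<omega>) \<Otimes>\<^sub>M distr M borel Z"
    unfolding G[symmetric] Z[symmetric] by (simp add: fun_cong[OF G, symmetric] fun_cong[OF Z, symmetric])
qed

text \<open>The exponents add up, so the joint density depends on \<open>x\<close> only through
  \<open>lp_sum p x\<close>; this is the form that the radial substitution requires.\<close>

lemma gen_gauss_density_prod:
  fixes x :: "real ^ 'n::finite"
  assumes "p > 0"
  shows "(\<Prod>i\<in>UNIV. ennreal (gen_gauss_density p (x $ i)))
    = ennreal ((1 / (2 * Gamma (1 + 1 / p))) ^ CARD('n)) * ennreal (exp (- lp_sum p x))"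
proof -
  have G: "Gamma (1 + 1 / p) > 0"
    using assms by (intro Gamma_real_pos) (auto intro: add_pos_pos)
  have "(\<Prod>i\<in>UNIV. ennreal (gen_gauss_density p (x $ i))) = ennreal (\<Prod>i\<in>UNIV. gen_gauss_density p (x $ i))"
    using G by (intro prod_ennreal) (auto simp: gen_gauss_density_def)
  also have "(\<Prod>i\<in>UNIV. gen_gauss_density p (x $ i))
      = (1 / (2 * Gamma (1 + 1 / p))) ^ CARD('n) * exp (- lp_sum p x)"
    by (simp add: gen_gauss_density_def prod_dividef exp_sum power_divide flip: sum_negf)
  finally show ?thesis
    using G by (simp add: ennreal_mult)
qed

text \<open>Independence turns the expectation into an iterated integral against the densities of
  the vector and of \<open>Z\<close>, to which \<open>nn_integral_radial_decoupling\<close> applies.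
  Only the last factor on the right involves \<open>F\<close>.\<close>

lemma (in prob_space) nn_integral_normalized_gen_gauss:
  fixes g :: "'n::finite \<Rightarrow> 'a \<Rightarrow> real" and F :: "real ^ 'n \<Rightarrow> ennreal"
  assumes p: "p > 0"
    and dg: "\<And>i. distributed M lborel (g i) (gen_gauss_density p)"
    and dZ: "distributed M lborel Z (exponential_density 1)"
    and indep: "indep_vars (\<lambda>_. borel) (case_option Z g) UNIV"
    and F [measurable]: "F \<in> borel_measurable borel"
  shows "(\<integral>\<^sup>+\<omega>. F ((1 / ((\<Sum>i\<in>UNIV. \<bar>g i \<omega>\<bar> powr p) + Z \<omega>) powr (1 / p)) *\<^sub>R (\<chi> i. g i \<omega>)) \<partial>M)
    = ennreal ((1 / (2 * Gamma (1 + 1 / p))) ^ CARD('n))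
      * (\<integral>\<^sup>+s. ennreal (exp (- s)) * ennreal (s powr (1 / p)) ^ CARD('n) * indicator {0<..} s \<partial>lborel)
      * (\<integral>\<^sup>+y. F y * indicator (lp_ball p) y \<partial>lborel)"
proof -
  define C where "C = ennreal ((1 / (2 * Gamma (1 + 1 / p))) ^ CARD('n))"
  define G where "G \<omega> = (\<chi> i. g i \<omega>)" for \<omega>
  define H where "H x t = F ((1 / (lp_sum p x + t) powr (1 / p)) *\<^sub>R x)" for x t
  have H_meas [measurable]: "case_prod H \<in> borel_measurable (borel \<Otimes>\<^sub>M borel)"
    unfolding H_def by measurable
  have g_meas [measurable]: "g i \<in> borel_measurable M" for i
    using distributed_measurable[OF dg[of i]] by simp
  have Z_meas [measurable]: "Z \<in> borel_measurable M"
    using distributed_measurable[OF dZ] by simp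
  have G_meas [measurable]: "G \<in> borel_measurable M"
    unfolding G_def by (rule borel_measurable_vec_lambda) simp
  have distr_Z: "distr M borel Z = density lborel (\<lambda>t. ennreal (exponential_density 1 t))"
    using distributed_distr_eq_density[OF dZ] by (simp cong: distr_cong)
  have "distr M borel G = density lborel (\<lambda>x. \<Prod>i\<in>UNIV. ennreal (gen_gauss_density p (x $ i)))"
    unfolding G_def by (rule distr_vec_indep[OF indep_vars_case_optionD(1)[OF indep] dg])
  then have distr_G: "distr M borel G = density lborel (\<lambda>x. C * ennreal (exp (- lp_sum p x)))"
    by (simp add: gen_gauss_density_prod[OF p] C_def)
  have joint: "distr M (borel \<Otimes>\<^sub>M borel) (\<lambda>\<omega>. (G \<omega>, Z \<omega>)) = distr M borel G \<Otimes>\<^sub>M distr M borel Z"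
    unfolding G_def by (rule indep_vars_case_optionD(2)[OF indep])
  \<comment> \<open>Supplies sigma-finiteness of the second factor, which Tonelli's theorem needs
    below.\<close>
  interpret DZ: prob_space "distr M borel Z"
    by (rule prob_space_distr) simp
  have "(\<integral>\<^sup>+\<omega>. H (G \<omega>) (Z \<omega>) \<partial>M)
      = (\<integral>\<^sup>+z. case_prod H z \<partial>distr M (borel \<Otimes>\<^sub>M borel) (\<lambda>\<omega>. (G \<omega>, Z \<omega>)))"
    by (subst nn_integral_distr) auto
  also have "\<dots> = (\<integral>\<^sup>+x. \<integral>\<^sup>+t. H x t \<partial>distr M borel Z \<partial>distr M borel G)"
    unfolding joint by (subst DZ.nn_integral_fst[symmetric]) (simp_all cong: measurable_cong_sets)
  also have "\<dots> = (\<integral>\<^sup>+x. \<integral>\<^sup>+t. ennreal (exponential_density 1 t) * H x t \<partial>lborel \<partial>distr M borel G)"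
    unfolding distr_Z by (intro nn_integral_cong nn_integral_density) auto
  also have "\<dots> = (\<integral>\<^sup>+x. C * ennreal (exp (- lp_sum p x))
      * (\<integral>\<^sup>+t. ennreal (exponential_density 1 t) * H x t \<partial>lborel) \<partial>lborel)"
    unfolding distr_G by (rule nn_integral_density) measurable
  also have "\<dots> = C * (\<integral>\<^sup>+x. ennreal (exp (- lp_sum p x))
      * (\<integral>\<^sup>+t. ennreal (exponential_density 1 t) * H x t \<partial>lborel) \<partial>lborel)"
    unfolding mult.assoc by (rule nn_integral_cmult) measurable
  finally show ?thesis
    unfolding H_def nn_integral_radial_decoupling[OF p F] C_def G_def by (simp add: mult.assoc)
qed

section \<open>Completed measures and the uniform law on the ball\<close>

text \<open>A set of the completion is a measurable set together with a subset of a null set. The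
  first part pulls back by measurability of \<open>f\<close>, the second stays inside a null set by
  the hypothesis on null sets.\<close>

lemma measurable_completion_of_null_sets:
  assumes f: "f \<in> M \<rightarrow>\<^sub>M N"
    and null: "\<And>A. A \<in> null_sets N \<Longrightarrow> f -` A \<inter> space M \<in> null_sets M"
  shows "f \<in> completion M \<rightarrow>\<^sub>M completion N"
proof (rule measurableI)
  fix A assume "A \<in> sets (completion N)"
  then obtain S T T' where A: "A = S \<union> T" "T \<subseteq> T'" "T' \<in> null_sets N" "S \<in> sets N"
    by (rule sets_completionE)
  have "f -` T \<inter> space M \<in> sets (completion M)"
    using A(2) null[OF A(3)]
    by (intro null_setsD2 null_sets_completion_subset[OF _ null_sets_completionI]) auto
  moreover have "f -` S \<inter> space M \<in> sets (completion M)"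
    using measurable_sets[OF f A(4)] by simp
  moreover have "f -` A \<inter> space (completion M) = (f -` S \<inter> space M) \<union> (f -` T \<inter> space M)"
    using A(1) by auto
  ultimately show "f -` A \<inter> space (completion M) \<in> sets (completion M)"
    by simp
qed (use f in \<open>auto dest: measurable_space\<close>)

theorem theorem1:
  fixes M :: "'a measure"
    and g :: "'n::finite \<Rightarrow> 'a \<Rightarrow> real"
    and Z :: "'a \<Rightarrow> real"
    and G V :: "'a \<Rightarrow> real ^ 'n"
    and p :: real
  assumes "prob_space M"
    and "p > 0"
    and "\<And>i. distributed M lborel (g i) (gen_gauss_density p)"
    and "distributed M lborel Z (exponential_density 1)"
    and "prob_space.indep_vars M (\<lambda>_. borel) (case_option Z g) UNIV"
    and "\<And>\<omega>. G \<omega> = (\<chi> i. g i \<omega>)"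
    and "\<And>\<omega>. V \<omega> = (1 / ((\<Sum>i\<in>UNIV. \<bar>g i \<omega>\<bar> powr p) + Z \<omega>) powr (1 / p)) *\<^sub>R G \<omega>"
  shows "(\<forall>A \<in> sets borel.
            measure M {\<omega> \<in> space M. V \<omega> \<in> A}
              = measure lebesgue (A \<inter> lp_ball p) / measure lebesgue (lp_ball p :: (real ^ 'n) set))
       \<and> (\<forall>A \<in> sets lebesgue.
            {\<omega> \<in> space M. V \<omega> \<in> A} \<in> sets (completion M) \<and>
            measure (completion M) {\<omega> \<in> space M. V \<omega> \<in> A}
              = measure lebesgue (A \<inter> lp_ball p) / measure lebesgue (lp_ball p :: (real ^ 'n) set))"
proof -
  interpret prob_space M by fact
  note p = \<open>p > 0\<close>
  define B where "B = (lp_ball p :: (real ^ 'n) set)"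
  \<comment> \<open>The constant common to all test functions; it is determined by total mass in
    \<open>one\<close>.\<close>
  define K where "K = ennreal ((1 / (2 * Gamma (1 + 1 / p))) ^ CARD('n))
    * (\<integral>\<^sup>+s. ennreal (exp (- s)) * ennreal (s powr (1 / p)) ^ CARD('n) * indicator {0<..} s \<partial>lborel)"
  have B [measurable]: "B \<in> sets borel"
    using p by (simp add: B_def sets_lp_ball)
  have g_meas [measurable]: "g i \<in> borel_measurable M" for i
    using distributed_measurable[OF assms(3)[of i]] by simp
  have Z_meas [measurable]: "Z \<in> borel_measurable M"
    using distributed_measurable[OF assms(4)] by simp
  have [measurable]: "G \<in> borel_measurable M"
    unfolding assms(6)[abs_def] by (rule borel_measurable_vec_lambda) simp
  have V_meas [measurable]: "V \<in> borel_measurable M"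
    unfolding assms(7)[abs_def] by measurable
  have law: "emeasure M (V -` A \<inter> space M) = K * emeasure lborel (A \<inter> B)"
    if [measurable]: "A \<in> sets borel" for A
  proof -
    have "emeasure M (V -` A \<inter> space M) = (\<integral>\<^sup>+\<omega>. indicator (V -` A \<inter> space M) \<omega> \<partial>M)"
      by (rule nn_integral_indicator[symmetric]) measurable
    also have "\<dots> = (\<integral>\<^sup>+\<omega>. indicator A (V \<omega>) \<partial>M)"
      by (rule nn_integral_cong) (simp add: indicator_def)
    also have "\<dots> = K * (\<integral>\<^sup>+y. indicator A y * indicator B y \<partial>lborel)"
      unfolding K_def B_def assms(6,7)
      by (rule nn_integral_normalized_gen_gauss[OF assms(2-5)]) simp
    also have "(\<integral>\<^sup>+y. indicator A y * indicator B y \<partial>lborel) = emeasure lborel (A \<inter> B)"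
      by (simp flip: indicator_inter_arith)
    finally show ?thesis .
  qed
  have one: "1 = K * emeasure lborel B"
    using law[of UNIV] by (simp add: emeasure_space_1)
  \<comment> \<open>By \<open>law\<close>, the distribution of \<open>V\<close> is absolutely
    continuous; this is what lets the result pass from Borel to Lebesgue measurable sets.\<close>
  have V_null: "V -` A \<inter> space M \<in> null_sets M" if "A \<in> null_sets lborel" for A
  proof -
    have "emeasure lborel (A \<inter> B) = 0"
      using that B by (metis null_setsD1 null_set_Int2 sets_lborel)
    then show ?thesis
      using law[of A] that by (auto intro!: null_setsI)
  qed
  have V_compl: "V \<in> completion M \<rightarrow>\<^sub>M lebesgue"
    by (rule measurable_completion_of_null_sets) (use V_null in auto)
  have law_completion: "emeasure (completion M) (V -` A \<inter> space M) = K * emeasure lebesgue (A \<inter> B)"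
    if A_sets: "A \<in> sets lebesgue" for A
  proof -
    obtain S T T' where A: "A = S \<union> T" "T \<subseteq> T'" "T' \<in> null_sets lborel" "S \<in> sets lborel"
      using A_sets by (rule sets_completionE)
    have T: "T \<in> null_sets lebesgue"
      using A by (metis null_sets_completion_subset null_sets_completionI)
    have VT: "V -` T \<inter> space M \<in> null_sets (completion M)"
      using A V_null[OF A(3)] by (intro null_sets_completion_subset[OF _ null_sets_completionI]) auto
    have "V -` A \<inter> space M = (V -` S \<inter> space M) \<union> (V -` T \<inter> space M)"
      using A by auto
    \<comment> \<open>The negligible part \<open>T\<close> is dropped on the probability side here
      and restored on the Lebesgue side after \<open>law\<close> has been applied to the Borel part
      \<open>S\<close>.\<close>
    then have "emeasure (completion M) (V -` A \<inter> space M) = emeasure M (V -` S \<inter> space M)"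
      using VT A(4) by (simp add: emeasure_Un_null_set)
    also have "\<dots> = K * emeasure lborel (S \<inter> B)"
      using A(4) by (intro law) simp
    also have "emeasure lborel (S \<inter> B) = emeasure lebesgue ((S \<inter> B) \<union> (T \<inter> B))"
      using T A(4) B by (subst emeasure_Un_null_set) (auto intro: null_set_Int2)
    also have "(S \<inter> B) \<union> (T \<inter> B) = A \<inter> B"
      using A(1) by auto
    finally show ?thesis .
  qed
  \<comment> \<open>Since \<open>enn2real\<close> sends infinity to 0, a product equal to 1 excludes
    both a null ball and one of infinite volume, so the volume need not be computed before dividing
    by it.\<close>
  have B_measure: "enn2real K * measure lebesgue B = 1"
    using arg_cong[OF one, of enn2real] B by (simp add: measure_def enn2real_mult)
  have "measure lebesgue B \<noteq> 0"
    using B_measure by (metis mult_zero_right zero_neq_one)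
  then have "enn2real K = 1 / measure lebesgue B"
    using B_measure by (rule eq_divide_imp)
  then have ratio: "enn2real K * measure lebesgue (A \<inter> B) = measure lebesgue (A \<inter> B) / measure lebesgue B" for A
    by simp
  have V_vimage: "{\<omega> \<in> space M. V \<omega> \<in> A} = V -` A \<inter> space M" for A
    by auto
  show ?thesis
    unfolding V_vimage B_def[symmetric] ratio[symmetric]
  proof (intro conjI ballI)
    fix A :: "(real ^ 'n) set" assume "A \<in> sets borel"
    then show "measure M (V -` A \<inter> space M) = enn2real K * measure lebesgue (A \<inter> B)"
      using law[of A] B by (simp add: measure_def enn2real_mult)
  next
    fix A :: "(real ^ 'n) set" assume "A \<in> sets lebesgue"
    then show "V -` A \<inter> space M \<in> sets (completion M)"
      "measure (completion M) (V -` A \<inter> space M) = enn2real K * measure lebesgue (A \<inter> B)"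
      using measurable_sets[OF V_compl, of A] law_completion[of A] by (simp_all add: measure_def enn2real_mult)
  qed
qed

end
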